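(* Let $\mathcal C$ be a (strict) monoidal category with coequalizers. Then there exists a bijective correspondence between the wreath (respectively cowreath) structures in ${\rm Bim}(\mathcal C)$ and pairs $(A,\mathfrak X)$ consisting of a coflat algebra $A$ in $\mathcal C$ and a wreath (respectively cowreath) $\mathfrak X$ in the monoidal category ${}_A\mathcal C_A^!$.
   Context: An object $X$ of $\mathcal C$ is left coflat if the functor $-\otimes X:\mathcal C\to\mathcal C$ preserves coequalizers, right coflat if $X\otimes-$ does, and coflat if it is both; a coflat algebra is an algebra in $\mathcal C$ whose underlying object is coflat. For an algebra $A$ in $\mathcal C$, a right $A$-module $M$ and a left $A$-module $Y$, $M\otimes_AY$ is the coequalizer of the two morphisms $M\otimes A\otimes Y\rightrightarrows M\otimes Y$ given by the actions. A right $A$-module $M$ is called right robust if for every left $A$-module $X$ and every object $Y$ of $\mathcal C$ the canonical morphism $M\otimes_A(X\otimes Y)\to(M\otimes_AX)\otimes Y$ is an isomorphism in $\mathcal C$. ${}_A\mathcal C_A^!$ is the full subcategory of the category of $A$-bimodules in $\mathcal C$ whose objects are right robust; it is regarded as a monoidal category with tensor product $\otimes_A$ and unit $A$. ${\rm Bim}(\mathcal C)$ is the bicategory (regarded as a 2-category) whose 0-cells are the coflat algebras in $\mathcal C$, whose 1-cells $A\to B$ are the right robust $(A,B)$-bimodules in $\mathcal C$ (right robust as right $B$-modules), and whose 2-cells are the bimodule morphisms in $\mathcal C$. Vertical composition of 2-cells is composition in $\mathcal C$; the composite of the 1-cells $M:A\to B$ and $N:B\to S$ is $M\otimes_BN$,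 with the horizontal composition of 2-cells induced accordingly. For a 2-category $\mathcal K$ ($\circ$ vertical, $\odot$ horizontal composition of 2-cells), $EM(\mathcal K)$ is the 2-category with 0-cells the monads $(A,t,\mu_t,\eta_t)$ in $\mathcal K$; 1-cells $(A,t)\to(B,s)$ the pairs $(f,\psi)$, with $f:A\to B$ a 1-cell and $\psi:sf\Rightarrow ft$ a 2-cell in $\mathcal K$ satisfying $(1_f\odot\mu_t)\circ(\psi\odot1_t)\circ(1_s\odot\psi)=\psi\circ(\mu_s\odot1_f)$ and $\psi\circ(\eta_s\odot1_f)=1_f\odot\eta_t$; 2-cells $(f,\psi)\Rightarrow(g,\phi)$ the 2-cells $\rho:f\Rightarrow gt$ in $\mathcal K$ with $(1_g\odot\mu_t)\circ(\rho\odot1_t)\circ\psi=(1_g\odot\mu_t)\circ(\phi\odot1_t)\circ(1_s\odot\rho)$; the vertical composite of $\rho:(f,\psi)\Rightarrow(g,\phi)$ and $\rho':(g,\phi)\Rightarrow(h,\gamma)$ is $(1_h\odot\mu_t)\circ(\rho'\odot1_t)\circ\rho$; the composite of 1-cells is $(g,\phi)(f,\psi)=(gf,(1_g\odot\psi)\circ(\phi\odot1_f))$; the horizontal composite of $\rho:(f,\psi)\Rightarrow(f',\psi')$ and $\rho':(g,\phi)\Rightarrow(g',\phi')$ is $(1_{g'}\odot1_{f'}\odot\mu_t)\circ(1_{g'}\odot\rho\odot1_t)\circ(1_{g'}\odot\psi)\circ(\rho'\odot1_f)$; the identity 2-cell of $(f,\psi)$ is $1_f\odot\eta_t$ and the identity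 1-cell of $(A,t)$ is $(1_A,1_t)$. A wreath (respectively cowreath) in $\mathcal K$ is a monad (respectively comonad) in $EM(\mathcal K)$. A wreath (cowreath) in a monoidal category is one in the corresponding 2-category with a single 0-cell, whose 1-cells are the objects, with composite $gf:=f\otimes g$, and whose 2-cells are the morphisms. *)

theory Defs
  imports Main
begin

section \<open>Strict monoidal categories and coequalizers\<close>

record ('o, 'a) category =
  Obj :: "'o set"
  Arr :: "'a set"
  Dom :: "'a \<Rightarrow> 'o"
  Cod :: "'a \<Rightarrow> 'o"
  ide :: "'o \<Rightarrow> 'a"
  Comp :: "'a \<Rightarrow> 'a \<Rightarrow> 'a"  (infixr "\<cdot>\<index>" 55)

record ('o, 'a) tensor_category = "('o, 'a) category" +
  Unit :: 'o
  TObj :: "'o \<Rightarrow> 'o \<Rightarrow> 'o"  (infixr "\<otimes>\<index>" 70)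
  TArr :: "'a \<Rightarrow> 'a \<Rightarrow> 'a"  (infixr "\<boxtimes>\<index>" 70)

definition hom :: "('o, 'a, 'z) category_scheme \<Rightarrow> 'o \<Rightarrow> 'o \<Rightarrow> 'a set" where
  "hom C x y = {f \<in> Arr C. Dom C f = x \<and> Cod C f = y}"

locale is_category =
  fixes C :: "('o, 'a, 'z) category_scheme" (structure)
  assumes Dom_closed: "f \<in> Arr C \<Longrightarrow> Dom C f \<in> Obj C"
    and Cod_closed: "f \<in> Arr C \<Longrightarrow> Cod C f \<in> Obj C"
    and ide_hom: "x \<in> Obj C \<Longrightarrow> ide C x \<in> hom C x x"
    and Comp_hom: "f \<in> hom C x y \<Longrightarrow> g \<in> hom C y z \<Longrightarrow> g \<cdot> f \<in> hom C x z"
    and Comp_assoc: "f \<in> hom C w x \<Longrightarrow> g \<in> hom C x y \<Longrightarrow> h \<in> hom C y z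
          \<Longrightarrow> h \<cdot> (g \<cdot> f) = (h \<cdot> g) \<cdot> f"
    and Comp_ide_left: "f \<in> hom C x y \<Longrightarrow> ide C y \<cdot> f = f"
    and Comp_ide_right: "f \<in> hom C x y \<Longrightarrow> f \<cdot> ide C x = f"

locale strict_monoidal_category = is_category C
  for C :: "('o, 'a) tensor_category" (structure) +
  assumes Unit_closed: "Unit C \<in> Obj C"
    and TObj_closed: "x \<in> Obj C \<Longrightarrow> y \<in> Obj C \<Longrightarrow> x \<otimes> y \<in> Obj C"
    and TArr_hom: "f \<in> hom C x x' \<Longrightarrow> g \<in> hom C y y' \<Longrightarrow> f \<boxtimes> g \<in> hom C (x \<otimes> y) (x' \<otimes> y')"
    and TArr_ide: "x \<in> Obj C \<Longrightarrow> y \<in> Obj C \<Longrightarrow> ide C x \<boxtimes> ide C y = ide C (x \<otimes> y)"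
    and TArr_Comp: "f \<in> hom C x x' \<Longrightarrow> f' \<in> hom C x' x'' \<Longrightarrow> g \<in> hom C y y' \<Longrightarrow> g' \<in> hom C y' y''
          \<Longrightarrow> (f' \<cdot> f) \<boxtimes> (g' \<cdot> g) = (f' \<boxtimes> g') \<cdot> (f \<boxtimes> g)"
    and TObj_assoc: "x \<in> Obj C \<Longrightarrow> y \<in> Obj C \<Longrightarrow> z \<in> Obj C \<Longrightarrow> (x \<otimes> y) \<otimes> z = x \<otimes> (y \<otimes> z)"
    and TObj_Unit_left: "x \<in> Obj C \<Longrightarrow> Unit C \<otimes> x = x"
    and TObj_Unit_right: "x \<in> Obj C \<Longrightarrow> x \<otimes> Unit C = x"
    and TArr_assoc: "f \<in> Arr C \<Longrightarrow> g \<in> Arr C \<Longrightarrow> h \<in> Arr C \<Longrightarrow> (f \<boxtimes> g) \<boxtimes> h = f \<boxtimes> (g \<boxtimes> h)"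
    and TArr_Unit_left: "f \<in> Arr C \<Longrightarrow> ide C (Unit C) \<boxtimes> f = f"
    and TArr_Unit_right: "f \<in> Arr C \<Longrightarrow> f \<boxtimes> ide C (Unit C) = f"

context
  fixes C :: "('o, 'a, 'z) category_scheme" (structure)
begin

definition inverse_arrows :: "'a \<Rightarrow> 'a \<Rightarrow> bool" where
  "inverse_arrows f g \<longleftrightarrow> f \<in> Arr C \<and> g \<in> hom C (Cod C f) (Dom C f)
     \<and> g \<cdot> f = ide C (Dom C f) \<and> f \<cdot> g = ide C (Cod C f)"

definition is_iso :: "'a \<Rightarrow> bool" where
  "is_iso f \<longleftrightarrow> (\<exists>g. inverse_arrows f g)"

definition inverse_arrow :: "'a \<Rightarrow> 'a" where
  "inverse_arrow f = (THE g. inverse_arrows f g)"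

definition parallel :: "'a \<Rightarrow> 'a \<Rightarrow> bool" where
  "parallel f g \<longleftrightarrow> f \<in> Arr C \<and> g \<in> Arr C \<and> Dom C f = Dom C g \<and> Cod C f = Cod C g"

definition is_coequalizer :: "'a \<Rightarrow> 'a \<Rightarrow> 'a \<Rightarrow> bool" where
  "is_coequalizer f g q \<longleftrightarrow> parallel f g \<and> q \<in> Arr C \<and> Dom C q = Cod C f \<and> q \<cdot> f = q \<cdot> g
     \<and> (\<forall>h \<in> Arr C. Dom C h = Cod C f \<and> h \<cdot> f = h \<cdot> g
           \<longrightarrow> (\<exists>!k. k \<in> hom C (Cod C q) (Cod C h) \<and> k \<cdot> q = h))"

definition has_coequalizers :: bool where
  "has_coequalizers \<longleftrightarrow> (\<forall>f g. parallel f g \<longrightarrow> (\<exists>q. is_coequalizer f g q))"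

definition coequalizer :: "'a \<Rightarrow> 'a \<Rightarrow> 'a" where
  "coequalizer f g = (SOME q. is_coequalizer f g q)"

text \<open>The morphism induced by \<open>h\<close> on the quotient \<open>q\<close>, i.e. the one whose composite
  with \<open>q\<close> is \<open>h\<close>.\<close>

definition induced :: "'a \<Rightarrow> 'a \<Rightarrow> 'a" where
  "induced q h = (THE k. k \<in> hom C (Cod C q) (Cod C h) \<and> k \<cdot> q = h)"

end


section \<open>Coflat algebras, modules, robustness\<close>

datatype ('o, 'a) algebra = Algebra (alg_obj: 'o) (alg_mult: 'a) (alg_unit: 'a)

text \<open>An \<open>(A, B)\<close>-bimodule: the algebras \<open>A\<close> and \<open>B\<close>, the underlying object, the
  left action of \<open>A\<close> and the right action of \<open>B\<close>.\<close>

datatype ('o, 'a) bimodule =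
  Bimodule (bim_left: "('o, 'a) algebra") (bim_right: "('o, 'a) algebra")
    (bim_obj: 'o) (bim_lact: 'a) (bim_ract: 'a)

datatype ('o, 'a) bimodule_map =
  Bimodule_map (bmap_dom: "('o, 'a) bimodule") (bmap_arr: 'a) (bmap_cod: "('o, 'a) bimodule")

context
  fixes C :: "('o, 'a) tensor_category" (structure)
begin

definition is_algebra :: "('o, 'a) algebra \<Rightarrow> bool" where
  "is_algebra A \<longleftrightarrow> (case A of Algebra a m u \<Rightarrow>
     a \<in> Obj C \<and> m \<in> hom C (a \<otimes> a) a \<and> u \<in> hom C (Unit C) a
     \<and> m \<cdot> (m \<boxtimes> ide C a) = m \<cdot> (ide C a \<boxtimes> m)
     \<and> m \<cdot> (u \<boxtimes> ide C a) = ide C a \<and> m \<cdot> (ide C a \<boxtimes> u) = ide C a)"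

definition left_coflat :: "'o \<Rightarrow> bool" where
  "left_coflat x \<longleftrightarrow> (\<forall>f g q. is_coequalizer C f g q
     \<longrightarrow> is_coequalizer C (f \<boxtimes> ide C x) (g \<boxtimes> ide C x) (q \<boxtimes> ide C x))"

definition right_coflat :: "'o \<Rightarrow> bool" where
  "right_coflat x \<longleftrightarrow> (\<forall>f g q. is_coequalizer C f g q
     \<longrightarrow> is_coequalizer C (ide C x \<boxtimes> f) (ide C x \<boxtimes> g) (ide C x \<boxtimes> q))"

definition coflat_algebra :: "('o, 'a) algebra \<Rightarrow> bool" where
  "coflat_algebra A \<longleftrightarrow> is_algebra A \<and> left_coflat (alg_obj A) \<and> right_coflat (alg_obj A)"

definition is_left_module :: "('o, 'a) algebra \<Rightarrow> 'o \<Rightarrow> 'a \<Rightarrow> bool" where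
  "is_left_module A x l \<longleftrightarrow> x \<in> Obj C \<and> l \<in> hom C (alg_obj A \<otimes> x) x
     \<and> l \<cdot> (alg_mult A \<boxtimes> ide C x) = l \<cdot> (ide C (alg_obj A) \<boxtimes> l)
     \<and> l \<cdot> (alg_unit A \<boxtimes> ide C x) = ide C x"

definition is_right_module :: "('o, 'a) algebra \<Rightarrow> 'o \<Rightarrow> 'a \<Rightarrow> bool" where
  "is_right_module A x r \<longleftrightarrow> x \<in> Obj C \<and> r \<in> hom C (x \<otimes> alg_obj A) x
     \<and> r \<cdot> (r \<boxtimes> ide C (alg_obj A)) = r \<cdot> (ide C x \<boxtimes> alg_mult A)
     \<and> r \<cdot> (ide C x \<boxtimes> alg_unit A) = ide C x"

text \<open>For a right module \<open>(x, r)\<close> and a left module \<open>(y, l)\<close> over the same algebra \<open>A\<close>,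
  the quotient morphism from \<open>x \<otimes> y\<close> to the tensor product over \<open>A\<close>; the tensor product itself
  is its codomain.\<close>

definition quot :: "'o \<Rightarrow> 'a \<Rightarrow> 'o \<Rightarrow> 'a \<Rightarrow> 'a" where
  "quot x r y l = coequalizer C (r \<boxtimes> ide C y) (ide C x \<boxtimes> l)"

text \<open>Here \<open>(y \<otimes> z, l \<boxtimes> ide z)\<close> is the left module \<open>Y \<otimes> Z\<close>.\<close>

definition right_robust :: "('o, 'a) algebra \<Rightarrow> 'o \<Rightarrow> 'a \<Rightarrow> bool" where
  "right_robust A x r \<longleftrightarrow> is_right_module A x r
     \<and> (\<forall>y l z. is_left_module A y l \<and> z \<in> Obj C
          \<longrightarrow> is_iso C (induced C (quot x r (y \<otimes> z) (l \<boxtimes> ide C z)) (quot x r y l \<boxtimes> ide C z)))"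

definition is_bimodule :: "('o, 'a) bimodule \<Rightarrow> bool" where
  "is_bimodule M \<longleftrightarrow> (case M of Bimodule A B x l r \<Rightarrow>
     is_left_module A x l \<and> is_right_module B x r
     \<and> r \<cdot> (l \<boxtimes> ide C (alg_obj B)) = l \<cdot> (ide C (alg_obj A) \<boxtimes> r))"

definition robust_bimodule :: "('o, 'a) bimodule \<Rightarrow> bool" where
  "robust_bimodule M \<longleftrightarrow> is_bimodule M \<and> right_robust (bim_right M) (bim_obj M) (bim_ract M)"

definition is_bimodule_map :: "('o, 'a) bimodule_map \<Rightarrow> bool" where
  "is_bimodule_map \<alpha> \<longleftrightarrow> (case \<alpha> of
     Bimodule_map (Bimodule A B x l r) f (Bimodule A' B' x' l' r') \<Rightarrow>
       A = A' \<and> B = B' \<and> f \<in> hom C x x'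
       \<and> f \<cdot> l = l' \<cdot> (ide C (alg_obj A) \<boxtimes> f) \<and> f \<cdot> r = r' \<cdot> (f \<boxtimes> ide C (alg_obj B)))"

definition regular_bimodule :: "('o, 'a) algebra \<Rightarrow> ('o, 'a) bimodule" where
  "regular_bimodule A = Bimodule A A (alg_obj A) (alg_mult A) (alg_mult A)"

definition bquot :: "('o, 'a) bimodule \<Rightarrow> ('o, 'a) bimodule \<Rightarrow> 'a" where
  "bquot M N = quot (bim_obj M) (bim_ract M) (bim_obj N) (bim_lact N)"

definition bim_tensor :: "('o, 'a) bimodule \<Rightarrow> ('o, 'a) bimodule \<Rightarrow> ('o, 'a) bimodule" where
  "bim_tensor M N = Bimodule (bim_left M) (bim_right N) (Cod C (bquot M N))
     (induced C (ide C (alg_obj (bim_left M)) \<boxtimes> bquot M N)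
        (bquot M N \<cdot> (bim_lact M \<boxtimes> ide C (bim_obj N))))
     (induced C (bquot M N \<boxtimes> ide C (alg_obj (bim_right N)))
        (bquot M N \<cdot> (ide C (bim_obj M) \<boxtimes> bim_ract N)))"

definition bmap_id :: "('o, 'a) bimodule \<Rightarrow> ('o, 'a) bimodule_map" where
  "bmap_id M = Bimodule_map M (ide C (bim_obj M)) M"

definition bmap_comp ::
    "('o, 'a) bimodule_map \<Rightarrow> ('o, 'a) bimodule_map \<Rightarrow> ('o, 'a) bimodule_map" where
  "bmap_comp \<beta> \<alpha> = Bimodule_map (bmap_dom \<alpha>) (bmap_arr \<beta> \<cdot> bmap_arr \<alpha>) (bmap_cod \<beta>)"

definition bmap_tensor ::
    "('o, 'a) bimodule_map \<Rightarrow> ('o, 'a) bimodule_map \<Rightarrow> ('o, 'a) bimodule_map" where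
  "bmap_tensor \<alpha> \<beta> =
     Bimodule_map (bim_tensor (bmap_dom \<alpha>) (bmap_dom \<beta>))
       (induced C (bquot (bmap_dom \<alpha>) (bmap_dom \<beta>))
          (bquot (bmap_cod \<alpha>) (bmap_cod \<beta>) \<cdot> (bmap_arr \<alpha> \<boxtimes> bmap_arr \<beta>)))
       (bim_tensor (bmap_cod \<alpha>) (bmap_cod \<beta>))"

definition bmap_inv :: "('o, 'a) bimodule_map \<Rightarrow> ('o, 'a) bimodule_map" where
  "bmap_inv \<alpha> = Bimodule_map (bmap_cod \<alpha>) (inverse_arrow C (bmap_arr \<alpha>)) (bmap_dom \<alpha>)"

text \<open>\<open>bmap_inv\<close> is meaningful only on invertible maps. It is applied below to the
  constraints, which are invertible whenever the right robust bimodules form a bicategory.\<close>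

text \<open>The associativity constraint from \<open>(M \<otimes> N) \<otimes> P\<close> to \<open>M \<otimes> (N \<otimes> P)\<close>
  (tensor products over the respective algebras) is the morphism compatible with the
  quotient morphisms from the tensor product of the three underlying objects.\<close>

definition bim_assoc ::
    "('o, 'a) bimodule \<Rightarrow> ('o, 'a) bimodule \<Rightarrow> ('o, 'a) bimodule \<Rightarrow> ('o, 'a) bimodule_map" where
  "bim_assoc M N P =
     Bimodule_map (bim_tensor (bim_tensor M N) P)
       (induced C (bquot (bim_tensor M N) P \<cdot> (bquot M N \<boxtimes> ide C (bim_obj P)))
          (bquot M (bim_tensor N P) \<cdot> (ide C (bim_obj M) \<boxtimes> bquot N P)))
       (bim_tensor M (bim_tensor N P))"

definition bim_lunit :: "('o, 'a) bimodule \<Rightarrow> ('o, 'a) bimodule_map" where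
  "bim_lunit M =
     Bimodule_map (bim_tensor (regular_bimodule (bim_left M)) M)
       (induced C (bquot (regular_bimodule (bim_left M)) M) (bim_lact M)) M"

definition bim_runit :: "('o, 'a) bimodule \<Rightarrow> ('o, 'a) bimodule_map" where
  "bim_runit M =
     Bimodule_map (bim_tensor M (regular_bimodule (bim_right M)))
       (induced C (bquot M (regular_bimodule (bim_right M))) (bim_ract M)) M"

end


section \<open>Monoidal categories and bicategories\<close>

text \<open>The constraints are stored together with their inverses. The associativity constraint
  goes from \<open>(x \<otimes> y) \<otimes> z\<close> to \<open>x \<otimes> (y \<otimes> z)\<close>.\<close>

record ('o, 'a) monoidal_category = "('o, 'a) tensor_category" +
  massoc :: "'o \<Rightarrow> 'o \<Rightarrow> 'o \<Rightarrow> 'a"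
  massoc_inv :: "'o \<Rightarrow> 'o \<Rightarrow> 'o \<Rightarrow> 'a"
  mlunit :: "'o \<Rightarrow> 'a"
  mlunit_inv :: "'o \<Rightarrow> 'a"
  mrunit :: "'o \<Rightarrow> 'a"
  mrunit_inv :: "'o \<Rightarrow> 'a"

text \<open>In \<open>g \<star> f\<close> and \<open>\<beta> \<odot> \<alpha>\<close> the left factor is applied last;
  \<open>bassoc h g f\<close> is the constraint \<open>(h \<star> g) \<star> f \<Rightarrow> h \<star> (g \<star> f)\<close>.\<close>

record ('c, 'f, 'm) bicategory =
  cells0 :: "'c set"
  cells1 :: "'f set"
  cells2 :: "'m set"
  src :: "'f \<Rightarrow> 'c"
  trg :: "'f \<Rightarrow> 'c"
  dom2 :: "'m \<Rightarrow> 'f"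
  cod2 :: "'m \<Rightarrow> 'f"
  id1 :: "'c \<Rightarrow> 'f"
  comp1 :: "'f \<Rightarrow> 'f \<Rightarrow> 'f"  (infixr "\<star>\<index>" 75)
  id2 :: "'f \<Rightarrow> 'm"
  vcomp :: "'m \<Rightarrow> 'm \<Rightarrow> 'm"  (infixr "\<bullet>\<index>" 55)
  hcomp :: "'m \<Rightarrow> 'm \<Rightarrow> 'm"  (infixr "\<odot>\<index>" 70)
  bassoc :: "'f \<Rightarrow> 'f \<Rightarrow> 'f \<Rightarrow> 'm"
  bassoc_inv :: "'f \<Rightarrow> 'f \<Rightarrow> 'f \<Rightarrow> 'm"
  blunit :: "'f \<Rightarrow> 'm"
  blunit_inv :: "'f \<Rightarrow> 'm"
  brunit :: "'f \<Rightarrow> 'm"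
  brunit_inv :: "'f \<Rightarrow> 'm"

definition hom1 :: "('c, 'f, 'm) bicategory \<Rightarrow> 'c \<Rightarrow> 'c \<Rightarrow> 'f set" where
  "hom1 K A B = {f \<in> cells1 K. src K f = A \<and> trg K f = B}"

definition hom2 :: "('c, 'f, 'm) bicategory \<Rightarrow> 'f \<Rightarrow> 'f \<Rightarrow> 'm set" where
  "hom2 K f g = {\<alpha> \<in> cells2 K. dom2 K \<alpha> = f \<and> cod2 K \<alpha> = g}"

text \<open>A monoidal category as a bicategory with one 0-cell. Since \<open>g \<star> f = f \<otimes> g\<close>, the
  associativity constraint gets inverted and left and right unit constraints are exchanged.\<close>

definition one_object_bicategory :: "('o, 'a) monoidal_category \<Rightarrow> (unit, 'o, 'a) bicategory" where
  "one_object_bicategory D =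
     \<lparr> cells0 = {()},
       cells1 = Obj D,
       cells2 = Arr D,
       src = (\<lambda>_. ()),
       trg = (\<lambda>_. ()),
       dom2 = Dom D,
       cod2 = Cod D,
       id1 = (\<lambda>_. Unit D),
       comp1 = (\<lambda>g f. TObj D f g),
       id2 = ide D,
       vcomp = Comp D,
       hcomp = (\<lambda>\<beta> \<alpha>. TArr D \<alpha> \<beta>),
       bassoc = (\<lambda>h g f. massoc_inv D f g h),
       bassoc_inv = (\<lambda>h g f. massoc D f g h),
       blunit = mrunit D,
       blunit_inv = mrunit_inv D,
       brunit = mlunit D,
       brunit_inv = mlunit_inv D \<rparr>"

text \<open>The monoidal category of right robust \<open>A\<close>-bimodules, with the tensor product over \<open>A\<close>.\<close>

definition robust_bimodules ::
    "('o, 'a) tensor_category \<Rightarrow> ('o, 'a) algebra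
      \<Rightarrow> (('o, 'a) bimodule, ('o, 'a) bimodule_map) monoidal_category" where
  "robust_bimodules C A =
     (let Ob = {M. robust_bimodule C M \<and> bim_left M = A \<and> bim_right M = A} in
     \<lparr> Obj = Ob,
       Arr = {\<alpha>. is_bimodule_map C \<alpha> \<and> bmap_dom \<alpha> \<in> Ob \<and> bmap_cod \<alpha> \<in> Ob},
       Dom = bmap_dom,
       Cod = bmap_cod,
       ide = bmap_id C,
       Comp = bmap_comp C,
       Unit = regular_bimodule A,
       TObj = bim_tensor C,
       TArr = bmap_tensor C,
       massoc = bim_assoc C,
       massoc_inv = (\<lambda>M N P. bmap_inv C (bim_assoc C M N P)),
       mlunit = bim_lunit C,
       mlunit_inv = (\<lambda>M. bmap_inv C (bim_lunit C M)),
       mrunit = bim_runit C,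
       mrunit_inv = (\<lambda>M. bmap_inv C (bim_runit C M)) \<rparr>)"

definition Bim ::
    "('o, 'a) tensor_category
      \<Rightarrow> (('o, 'a) algebra, ('o, 'a) bimodule, ('o, 'a) bimodule_map) bicategory" where
  "Bim C =
     (let cells = {M. robust_bimodule C M \<and> coflat_algebra C (bim_left M)
                     \<and> coflat_algebra C (bim_right M)} in
     \<lparr> cells0 = {A. coflat_algebra C A},
       cells1 = cells,
       cells2 = {\<alpha>. is_bimodule_map C \<alpha> \<and> bmap_dom \<alpha> \<in> cells \<and> bmap_cod \<alpha> \<in> cells},
       src = bim_left,
       trg = bim_right,
       dom2 = bmap_dom,
       cod2 = bmap_cod,
       id1 = regular_bimodule,
       comp1 = (\<lambda>N M. bim_tensor C M N),
       id2 = bmap_id C,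
       vcomp = bmap_comp C,
       hcomp = (\<lambda>\<beta> \<alpha>. bmap_tensor C \<alpha> \<beta>),
       bassoc = (\<lambda>P N M. bmap_inv C (bim_assoc C M N P)),
       bassoc_inv = (\<lambda>P N M. bim_assoc C M N P),
       blunit = bim_runit C,
       blunit_inv = (\<lambda>M. bmap_inv C (bim_runit C M)),
       brunit = bim_lunit C,
       brunit_inv = (\<lambda>M. bmap_inv C (bim_lunit C M)) \<rparr>)"


section \<open>Monads, comonads and the Eilenberg-Moore construction\<close>

text \<open>Data of a monad (0-cell, endo-1-cell, multiplication, unit) or of a comonad
  (0-cell, endo-1-cell, comultiplication, counit).\<close>

datatype ('c, 'f, 'm) monad =
  Monad (mon_base: 'c) (mon_cell: 'f) (mon_mult: 'm) (mon_unit: 'm)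

definition is_monad :: "('c, 'f, 'm) bicategory \<Rightarrow> ('c, 'f, 'm) monad \<Rightarrow> bool" where
  "is_monad K T \<longleftrightarrow> (case T of Monad A t \<mu> \<eta> \<Rightarrow>
     A \<in> cells0 K \<and> t \<in> hom1 K A A \<and> \<mu> \<in> hom2 K (t \<star>\<^bsub>K\<^esub> t) t \<and> \<eta> \<in> hom2 K (id1 K A) t
     \<and> \<mu> \<bullet>\<^bsub>K\<^esub> (\<mu> \<odot>\<^bsub>K\<^esub> id2 K t) = \<mu> \<bullet>\<^bsub>K\<^esub> (id2 K t \<odot>\<^bsub>K\<^esub> \<mu>) \<bullet>\<^bsub>K\<^esub> bassoc K t t t
     \<and> \<mu> \<bullet>\<^bsub>K\<^esub> (\<eta> \<odot>\<^bsub>K\<^esub> id2 K t) = blunit K t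
     \<and> \<mu> \<bullet>\<^bsub>K\<^esub> (id2 K t \<odot>\<^bsub>K\<^esub> \<eta>) = brunit K t)"

definition is_comonad :: "('c, 'f, 'm) bicategory \<Rightarrow> ('c, 'f, 'm) monad \<Rightarrow> bool" where
  "is_comonad K T \<longleftrightarrow> (case T of Monad A t \<delta> \<epsilon> \<Rightarrow>
     A \<in> cells0 K \<and> t \<in> hom1 K A A \<and> \<delta> \<in> hom2 K t (t \<star>\<^bsub>K\<^esub> t) \<and> \<epsilon> \<in> hom2 K t (id1 K A)
     \<and> bassoc K t t t \<bullet>\<^bsub>K\<^esub> (\<delta> \<odot>\<^bsub>K\<^esub> id2 K t) \<bullet>\<^bsub>K\<^esub> \<delta> = (id2 K t \<odot>\<^bsub>K\<^esub> \<delta>) \<bullet>\<^bsub>K\<^esub> \<delta>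
     \<and> blunit K t \<bullet>\<^bsub>K\<^esub> (\<epsilon> \<odot>\<^bsub>K\<^esub> id2 K t) \<bullet>\<^bsub>K\<^esub> \<delta> = id2 K t
     \<and> brunit K t \<bullet>\<^bsub>K\<^esub> (id2 K t \<odot>\<^bsub>K\<^esub> \<epsilon>) \<bullet>\<^bsub>K\<^esub> \<delta> = id2 K t)"

text \<open>1-cells \<open>(f, \<psi>)\<close> and 2-cells \<open>\<rho>\<close> of the Eilenberg-Moore bicategory, together with
  source and target.\<close>

datatype ('c, 'f, 'm) em1 =
  EM1 (em_src: "('c, 'f, 'm) monad") (em_trg: "('c, 'f, 'm) monad") (em_cell: 'f) (em_psi: 'm)

datatype ('c, 'f, 'm) em2 =
  EM2 (em_dom: "('c, 'f, 'm) em1") (em_rho: 'm) (em_cod: "('c, 'f, 'm) em1")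

text \<open>The formulas are those for 2-categories with the constraints of \<open>K\<close> inserted.\<close>

context
  fixes K :: "('c, 'f, 'm) bicategory" (structure)
begin

definition is_em1 :: "('c, 'f, 'm) em1 \<Rightarrow> bool" where
  "is_em1 F \<longleftrightarrow> (case F of EM1 (Monad A t \<mu>\<^sub>t \<eta>\<^sub>t) (Monad B s \<mu>\<^sub>s \<eta>\<^sub>s) f \<psi> \<Rightarrow>
     is_monad K (Monad A t \<mu>\<^sub>t \<eta>\<^sub>t) \<and> is_monad K (Monad B s \<mu>\<^sub>s \<eta>\<^sub>s)
     \<and> f \<in> hom1 K A B \<and> \<psi> \<in> hom2 K (s \<star> f) (f \<star> t)
     \<and> (id2 K f \<odot> \<mu>\<^sub>t) \<bullet> bassoc K f t t \<bullet> (\<psi> \<odot> id2 K t) \<bullet> bassoc_inv K s f t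
          \<bullet> (id2 K s \<odot> \<psi>) \<bullet> bassoc K s s f
        = \<psi> \<bullet> (\<mu>\<^sub>s \<odot> id2 K f)
     \<and> \<psi> \<bullet> (\<eta>\<^sub>s \<odot> id2 K f) = (id2 K f \<odot> \<eta>\<^sub>t) \<bullet> brunit_inv K f \<bullet> blunit K f)"

definition is_em2 :: "('c, 'f, 'm) em2 \<Rightarrow> bool" where
  "is_em2 R \<longleftrightarrow> (case R of EM2 (EM1 T S f \<psi>) \<rho> (EM1 T' S' g \<phi>) \<Rightarrow>
     is_em1 (EM1 T S f \<psi>) \<and> is_em1 (EM1 T' S' g \<phi>) \<and> T = T' \<and> S = S'
     \<and> (let t = mon_cell T; \<mu> = mon_mult T; s = mon_cell S in
          \<rho> \<in> hom2 K f (g \<star> t)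
          \<and> (id2 K g \<odot> \<mu>) \<bullet> bassoc K g t t \<bullet> (\<rho> \<odot> id2 K t) \<bullet> \<psi>
            = (id2 K g \<odot> \<mu>) \<bullet> bassoc K g t t \<bullet> (\<phi> \<odot> id2 K t) \<bullet> bassoc_inv K s g t
                \<bullet> (id2 K s \<odot> \<rho>)))"

definition em_id1 :: "('c, 'f, 'm) monad \<Rightarrow> ('c, 'f, 'm) em1" where
  "em_id1 T = EM1 T T (id1 K (mon_base T))
     (blunit_inv K (mon_cell T) \<bullet> brunit K (mon_cell T))"

definition em_comp1 :: "('c, 'f, 'm) em1 \<Rightarrow> ('c, 'f, 'm) em1 \<Rightarrow> ('c, 'f, 'm) em1" where
  "em_comp1 G F =
     (let t = mon_cell (em_src F); s = mon_cell (em_src G); r = mon_cell (em_trg G);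
          f = em_cell F; g = em_cell G in
      EM1 (em_src F) (em_trg G) (g \<star> f)
        (bassoc_inv K g f t \<bullet> (id2 K g \<odot> em_psi F) \<bullet> bassoc K g s f
           \<bullet> (em_psi G \<odot> id2 K f) \<bullet> bassoc_inv K r g f))"

text \<open>The 2-cell from \<open>F\<close> to \<open>G\<close> given by a 2-cell \<open>\<alpha>\<close> of \<open>K\<close> between their underlying 1-cells.\<close>

definition em_lift :: "('c, 'f, 'm) em1 \<Rightarrow> 'm \<Rightarrow> ('c, 'f, 'm) em1 \<Rightarrow> ('c, 'f, 'm) em2" where
  "em_lift F \<alpha> G =
     EM2 F ((id2 K (em_cell G) \<odot> mon_unit (em_src G)) \<bullet> brunit_inv K (em_cell G) \<bullet> \<alpha>) G"

definition em_id2 :: "('c, 'f, 'm) em1 \<Rightarrow> ('c, 'f, 'm) em2" where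
  "em_id2 F =
     EM2 F ((id2 K (em_cell F) \<odot> mon_unit (em_src F)) \<bullet> brunit_inv K (em_cell F)) F"

definition em_vcomp :: "('c, 'f, 'm) em2 \<Rightarrow> ('c, 'f, 'm) em2 \<Rightarrow> ('c, 'f, 'm) em2" where
  "em_vcomp R' R =
     (let T = em_src (em_dom R); t = mon_cell T; h = em_cell (em_cod R') in
      EM2 (em_dom R)
        ((id2 K h \<odot> mon_mult T) \<bullet> bassoc K h t t \<bullet> (em_rho R' \<odot> id2 K t) \<bullet> em_rho R)
        (em_cod R'))"

definition em_hcomp :: "('c, 'f, 'm) em2 \<Rightarrow> ('c, 'f, 'm) em2 \<Rightarrow> ('c, 'f, 'm) em2" where
  "em_hcomp R' R =
     (let F = em_dom R; F' = em_cod R; G = em_dom R'; G' = em_cod R';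
          f = em_cell F; f' = em_cell F'; g' = em_cell G';
          T = em_src F; t = mon_cell T; s = mon_cell (em_trg F) in
      EM2 (em_comp1 G F)
        (bassoc_inv K g' f' t
           \<bullet> (id2 K g' \<odot> (id2 K f' \<odot> mon_mult T))
           \<bullet> (id2 K g' \<odot> bassoc K f' t t)
           \<bullet> (id2 K g' \<odot> (em_rho R \<odot> id2 K t))
           \<bullet> (id2 K g' \<odot> em_psi F)
           \<bullet> bassoc K g' s f
           \<bullet> (em_rho R' \<odot> id2 K f))
        (em_comp1 G' F'))"

definition EM ::
    "(('c, 'f, 'm) monad, ('c, 'f, 'm) em1, ('c, 'f, 'm) em2) bicategory" where
  "EM =
     \<lparr> cells0 = {T. is_monad K T},
       cells1 = {F. is_em1 F},
       cells2 = {R. is_em2 R},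
       src = em_src,
       trg = em_trg,
       dom2 = em_dom,
       cod2 = em_cod,
       id1 = em_id1,
       comp1 = em_comp1,
       id2 = em_id2,
       vcomp = em_vcomp,
       hcomp = em_hcomp,
       bassoc = (\<lambda>H G F. em_lift (em_comp1 (em_comp1 H G) F)
                   (bassoc K (em_cell H) (em_cell G) (em_cell F))
                   (em_comp1 H (em_comp1 G F))),
       bassoc_inv = (\<lambda>H G F. em_lift (em_comp1 H (em_comp1 G F))
                   (bassoc_inv K (em_cell H) (em_cell G) (em_cell F))
                   (em_comp1 (em_comp1 H G) F)),
       blunit = (\<lambda>F. em_lift (em_comp1 (em_id1 (em_trg F)) F) (blunit K (em_cell F)) F),
       blunit_inv = (\<lambda>F. em_lift F (blunit_inv K (em_cell F)) (em_comp1 (em_id1 (em_trg F)) F)),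
       brunit = (\<lambda>F. em_lift (em_comp1 F (em_id1 (em_src F))) (brunit K (em_cell F)) F),
       brunit_inv = (\<lambda>F. em_lift F (brunit_inv K (em_cell F)) (em_comp1 F (em_id1 (em_src F)))) \<rparr>"

end


section \<open>Wreaths and cowreaths\<close>

type_synonym ('c, 'f, 'm) wreath =
  "(('c, 'f, 'm) monad, ('c, 'f, 'm) em1, ('c, 'f, 'm) em2) monad"

definition wreaths :: "('c, 'f, 'm) bicategory \<Rightarrow> ('c, 'f, 'm) wreath set" where
  "wreaths K = {W. is_monad (EM K) W}"

definition cowreaths :: "('c, 'f, 'm) bicategory \<Rightarrow> ('c, 'f, 'm) wreath set" where
  "cowreaths K = {W. is_comonad (EM K) W}"

text \<open>The correspondence sends a (co)wreath in \<open>Bim C\<close> to its underlying 0-cell \<open>A\<close> together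
  with the same 1-cells and 2-cells, now read in the monoidal category of right robust
  \<open>A\<close>-bimodules, whose only 0-cell is \<open>()\<close>.\<close>

definition wreath_to_pair :: "('c, 'f, 'm) wreath \<Rightarrow> 'c \<times> (unit, 'f, 'm) wreath" where
  "wreath_to_pair W =
     (mon_base (mon_base W),
      map_monad (map_monad (\<lambda>_. ()) id id) (map_em1 (\<lambda>_. ()) id id) (map_em2 (\<lambda>_. ()) id id) W)"

end

theory Submission
  imports Defs
begin

text \<open>A wreath in a bicategory \<open>\<K>\<close> involves only a single 0-cell \<open>A\<close> of \<open>\<K>\<close>: its 1-cells are
  endo-1-cells of \<open>A\<close> and its 2-cells go between such 1-cells. Hence it is the same thing as a wreath
  in the bicategory with one 0-cell whose 1-cells are the endo-1-cells of \<open>A\<close>. For \<open>\<K> = Bim(\<C>)\<close>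
  and a coflat algebra \<open>A\<close>, this one-object bicategory is the monoidal category of right robust
  \<open>A\<close>-bimodules, with the same tensor products over \<open>A\<close> and the same constraints, so that the
  wreaths with underlying 0-cell \<open>A\<close> are the wreaths in that monoidal category; letting \<open>A\<close> vary
  gives the bijection. The same holds for cowreaths.

  To make ``the same thing'' precise through the two layers of structure (monads in \<open>\<K>\<close>, and then
  monads in \<open>EM(\<K>)\<close>), the comparison is relational. A \<^emph>\<open>bicategory correspondence\<close> consists of
  one-to-one relations between the 0-cells, 1-cells and 2-cells of \<open>\<K>\<close> and \<open>\<K>'\<close> which all operations
  respect and for which related hom-sets correspond elementwise. Three facts then suffice.
  Being a monad or a comonad is invariant under such a correspondence, because it is expressed by
  the operations alone (\<open>is_monad_transfer\<close>, \<open>is_comonad_transfer\<close>), and related 0-cells carry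
  corresponding monads, because related hom-sets correspond (\<open>monad_left_total\<close> and its companions).
  The construction \<open>EM\<close> turns a correspondence between \<open>\<K>\<close> and \<open>\<K>'\<close> into one between \<open>EM(\<K>)\<close> and
  \<open>EM(\<K>')\<close> (\<open>EM_correspondence\<close>), so that the first fact applies to wreaths. And relating \<open>A\<close> to
  the unique 0-cell, and every \<open>A\<close>-bimodule and every 2-cell to itself, is a correspondence
  between \<open>Bim(\<C>)\<close> and the monoidal category of right robust \<open>A\<close>-bimodules
  (\<open>Bim_correspondence\<close>).\<close>

section \<open>Correspondences of bicategories\<close>

unbundle lifting_syntax

text \<open>The relations may be partial. The 0-cells outside the domain of \<open>R0\<close> have to be ignored, so the
  sets of 0-cells are compared only on related pairs. For 1-cells and 2-cells the comparison
  of hom-sets by \<open>rel_set\<close> is stronger: every cell with related source and target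
  has a partner. The operations are required to respect the relations on all related
  arguments, whether composable or not.\<close>

locale bicategory_correspondence =
  fixes K :: "('c, 'f, 'm) bicategory" and K' :: "('d, 'g, 'n) bicategory"
    and R0 :: "'c \<Rightarrow> 'd \<Rightarrow> bool" and R1 :: "'f \<Rightarrow> 'g \<Rightarrow> bool" and R2 :: "'m \<Rightarrow> 'n \<Rightarrow> bool"
  assumes bi_unique0 [transfer_rule]: "bi_unique R0"
    and bi_unique1 [transfer_rule]: "bi_unique R1"
    and bi_unique2 [transfer_rule]: "bi_unique R2"
    and cells0_iff: "R0 A A' \<Longrightarrow> A \<in> cells0 K \<longleftrightarrow> A' \<in> cells0 K'"
    and hom1_transfer [transfer_rule]: "(R0 ===> R0 ===> rel_set R1) (hom1 K) (hom1 K')"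
    and hom2_transfer [transfer_rule]: "(R1 ===> R1 ===> rel_set R2) (hom2 K) (hom2 K')"
    and id1_transfer [transfer_rule]: "(R0 ===> R1) (id1 K) (id1 K')"
    and comp1_transfer [transfer_rule]: "(R1 ===> R1 ===> R1) (comp1 K) (comp1 K')"
    and id2_transfer [transfer_rule]: "(R1 ===> R2) (id2 K) (id2 K')"
    and vcomp_transfer [transfer_rule]: "(R2 ===> R2 ===> R2) (vcomp K) (vcomp K')"
    and hcomp_transfer [transfer_rule]: "(R2 ===> R2 ===> R2) (hcomp K) (hcomp K')"
    and bassoc_transfer [transfer_rule]:
      "(R1 ===> R1 ===> R1 ===> R2) (bassoc K) (bassoc K')"
    and bassoc_inv_transfer [transfer_rule]:
      "(R1 ===> R1 ===> R1 ===> R2) (bassoc_inv K) (bassoc_inv K')"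
    and blunit_transfer [transfer_rule]: "(R1 ===> R2) (blunit K) (blunit K')"
    and blunit_inv_transfer [transfer_rule]: "(R1 ===> R2) (blunit_inv K) (blunit_inv K')"
    and brunit_transfer [transfer_rule]: "(R1 ===> R2) (brunit K) (brunit K')"
    and brunit_inv_transfer [transfer_rule]: "(R1 ===> R2) (brunit_inv K) (brunit_inv K')"
begin

lemma hom1_left_total:
  assumes "f \<in> hom1 K A B" "R0 A A'" "R0 B B'"
  obtains f' where "f' \<in> hom1 K' A' B'" "R1 f f'"
  using assms hom1_transfer by (fastforce simp: rel_fun_def rel_set_def)

lemma hom1_right_total:
  assumes "f' \<in> hom1 K' A' B'" "R0 A A'" "R0 B B'"
  obtains f where "f \<in> hom1 K A B" "R1 f f'"
  using assms hom1_transfer by (fastforce simp: rel_fun_def rel_set_def)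

lemma hom2_left_total:
  assumes "\<alpha> \<in> hom2 K f g" "R1 f f'" "R1 g g'"
  obtains \<alpha>' where "\<alpha>' \<in> hom2 K' f' g'" "R2 \<alpha> \<alpha>'"
  using assms hom2_transfer by (fastforce simp: rel_fun_def rel_set_def)

lemma hom2_right_total:
  assumes "\<alpha>' \<in> hom2 K' f' g'" "R1 f f'" "R1 g g'"
  obtains \<alpha> where "\<alpha> \<in> hom2 K f g" "R2 \<alpha> \<alpha>'"
  using assms hom2_transfer by (fastforce simp: rel_fun_def rel_set_def)

lemma comp1_rel: "R1 g g' \<Longrightarrow> R1 f f' \<Longrightarrow> R1 (comp1 K g f) (comp1 K' g' f')"
  using comp1_transfer by (simp add: rel_fun_def)

lemma id1_rel: "R0 A A' \<Longrightarrow> R1 (id1 K A) (id1 K' A')"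
  using id1_transfer by (simp add: rel_fun_def)


section \<open>Monads and comonads under a correspondence\<close>

text \<open>The condition that the base is a 0-cell is transferred as a predicate rather than as membership
  in a set: \<open>cells0 K\<close> and \<open>cells0 K'\<close> need not be related by \<open>rel_set R0\<close>.\<close>

lemma is_monad_transfer [transfer_rule]:
  "(rel_monad R0 R1 R2 ===> (=)) (is_monad K) (is_monad K')"
proof -
  define P where "P = (\<lambda>A. A \<in> cells0 K)"
  define P' where "P' = (\<lambda>A. A \<in> cells0 K')"
  have [transfer_rule]: "(R0 ===> (=)) P P'"
    by (simp add: P_def P'_def rel_fun_def cells0_iff)
  have P: "A \<in> cells0 K \<longleftrightarrow> P A" and P': "A' \<in> cells0 K' \<longleftrightarrow> P' A'" for A A'
    by (simp_all add: P_def P'_def)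
  show ?thesis
    unfolding is_monad_def P P' by transfer_prover
qed

lemma is_comonad_transfer [transfer_rule]:
  "(rel_monad R0 R1 R2 ===> (=)) (is_comonad K) (is_comonad K')"
proof -
  define P where "P = (\<lambda>A. A \<in> cells0 K)"
  define P' where "P' = (\<lambda>A. A \<in> cells0 K')"
  have [transfer_rule]: "(R0 ===> (=)) P P'"
    by (simp add: P_def P'_def rel_fun_def cells0_iff)
  have P: "A \<in> cells0 K \<longleftrightarrow> P A" and P': "A' \<in> cells0 K' \<longleftrightarrow> P' A'" for A A'
    by (simp_all add: P_def P'_def)
  show ?thesis
    unfolding is_comonad_def P P' by transfer_prover
qed

text \<open>The cell, multiplication and unit of a monad on \<open>A\<close> lie in hom-sets determined by \<open>A\<close> and, in
  turn, by the cell. So partners can be chosen one after the other, starting from a partner of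
  \<open>A\<close>. The same works for comonads and in the opposite direction.\<close>

lemma monad_left_total:
  assumes "is_monad K W" "R0 (mon_base W) A'"
  obtains W' where "is_monad K' W'" "rel_monad R0 R1 R2 W W'"
proof (cases W)
  case (Monad A t \<mu> \<eta>)
  with assms have t: "t \<in> hom1 K A A" and \<mu>: "\<mu> \<in> hom2 K (comp1 K t t) t"
    and \<eta>: "\<eta> \<in> hom2 K (id1 K A) t" and A: "R0 A A'"
    by (auto simp: is_monad_def)
  obtain t' where t': "R1 t t'"
    using hom1_left_total [OF t A A] .
  obtain \<mu>' where \<mu>': "R2 \<mu> \<mu>'"
    using hom2_left_total [OF \<mu> comp1_rel [OF t' t'] t'] .
  obtain \<eta>' where \<eta>': "R2 \<eta> \<eta>'"
    using hom2_left_total [OF \<eta> id1_rel [OF A] t'] .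
  have "rel_monad R0 R1 R2 W (Monad A' t' \<mu>' \<eta>')"
    using Monad A t' \<mu>' \<eta>' by simp
  with assms(1) that show thesis
    using is_monad_transfer by (auto simp: rel_fun_def)
qed

lemma monad_right_total:
  assumes "is_monad K' W'" "R0 A (mon_base W')"
  obtains W where "is_monad K W" "rel_monad R0 R1 R2 W W'"
proof (cases W')
  case (Monad A' t' \<mu>' \<eta>')
  with assms have t': "t' \<in> hom1 K' A' A'" and \<mu>': "\<mu>' \<in> hom2 K' (comp1 K' t' t') t'"
    and \<eta>': "\<eta>' \<in> hom2 K' (id1 K' A') t'" and A: "R0 A A'"
    by (auto simp: is_monad_def)
  obtain t where t: "R1 t t'"
    using hom1_right_total [OF t' A A] .
  obtain \<mu> where \<mu>: "R2 \<mu> \<mu>'"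
    using hom2_right_total [OF \<mu>' comp1_rel [OF t t] t] .
  obtain \<eta> where \<eta>: "R2 \<eta> \<eta>'"
    using hom2_right_total [OF \<eta>' id1_rel [OF A] t] .
  have "rel_monad R0 R1 R2 (Monad A t \<mu> \<eta>) W'"
    using Monad A t \<mu> \<eta> by simp
  with assms(1) that show thesis
    using is_monad_transfer by (auto simp: rel_fun_def)
qed

lemma comonad_left_total:
  assumes "is_comonad K W" "R0 (mon_base W) A'"
  obtains W' where "is_comonad K' W'" "rel_monad R0 R1 R2 W W'"
proof (cases W)
  case (Monad A t \<delta> \<epsilon>)
  with assms have t: "t \<in> hom1 K A A" and \<delta>: "\<delta> \<in> hom2 K t (comp1 K t t)"
    and \<epsilon>: "\<epsilon> \<in> hom2 K t (id1 K A)" and A: "R0 A A'"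
    by (auto simp: is_comonad_def)
  obtain t' where t': "R1 t t'"
    using hom1_left_total [OF t A A] .
  obtain \<delta>' where \<delta>': "R2 \<delta> \<delta>'"
    using hom2_left_total [OF \<delta> t' comp1_rel [OF t' t']] .
  obtain \<epsilon>' where \<epsilon>': "R2 \<epsilon> \<epsilon>'"
    using hom2_left_total [OF \<epsilon> t' id1_rel [OF A]] .
  have "rel_monad R0 R1 R2 W (Monad A' t' \<delta>' \<epsilon>')"
    using Monad A t' \<delta>' \<epsilon>' by simp
  with assms(1) that show thesis
    using is_comonad_transfer by (auto simp: rel_fun_def)
qed

lemma comonad_right_total:
  assumes "is_comonad K' W'" "R0 A (mon_base W')"
  obtains W where "is_comonad K W" "rel_monad R0 R1 R2 W W'"
proof (cases W')
  case (Monad A' t' \<delta>' \<epsilon>')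
  with assms have t': "t' \<in> hom1 K' A' A'" and \<delta>': "\<delta>' \<in> hom2 K' t' (comp1 K' t' t')"
    and \<epsilon>': "\<epsilon>' \<in> hom2 K' t' (id1 K' A')" and A: "R0 A A'"
    by (auto simp: is_comonad_def)
  obtain t where t: "R1 t t'"
    using hom1_right_total [OF t' A A] .
  obtain \<delta> where \<delta>: "R2 \<delta> \<delta>'"
    using hom2_right_total [OF \<delta>' t comp1_rel [OF t t]] .
  obtain \<epsilon> where \<epsilon>: "R2 \<epsilon> \<epsilon>'"
    using hom2_right_total [OF \<epsilon>' t id1_rel [OF A]] .
  have "rel_monad R0 R1 R2 (Monad A t \<delta> \<epsilon>) W'"
    using Monad A t \<delta> \<epsilon> by simp
  with assms(1) that show thesis
    using is_comonad_transfer by (auto simp: rel_fun_def)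
qed


section \<open>The Eilenberg-Moore construction under a correspondence\<close>

lemmas [transfer_rule] = monad.ctr_transfer monad.case_transfer monad.sel_transfer
  monad.bi_unique_rel em1.ctr_transfer em1.case_transfer em1.sel_transfer em1.bi_unique_rel
  em2.ctr_transfer em2.case_transfer em2.sel_transfer em2.bi_unique_rel

lemma is_em1_transfer [transfer_rule]:
  "(rel_em1 R0 R1 R2 ===> (=)) (is_em1 K) (is_em1 K')"
  unfolding is_em1_def by transfer_prover

lemma is_em2_transfer [transfer_rule]:
  "(rel_em2 R0 R1 R2 ===> (=)) (is_em2 K) (is_em2 K')"
  unfolding is_em2_def by transfer_prover

lemma em_id1_transfer [transfer_rule]:
  "(rel_monad R0 R1 R2 ===> rel_em1 R0 R1 R2) (em_id1 K) (em_id1 K')"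
  unfolding em_id1_def by transfer_prover

lemma em_comp1_transfer [transfer_rule]:
  "(rel_em1 R0 R1 R2 ===> rel_em1 R0 R1 R2 ===> rel_em1 R0 R1 R2) (em_comp1 K) (em_comp1 K')"
  unfolding em_comp1_def by transfer_prover

lemma em_lift_transfer [transfer_rule]:
  "(rel_em1 R0 R1 R2 ===> R2 ===> rel_em1 R0 R1 R2 ===> rel_em2 R0 R1 R2)
     (em_lift K) (em_lift K')"
  unfolding em_lift_def by transfer_prover

lemma em_id2_transfer [transfer_rule]:
  "(rel_em1 R0 R1 R2 ===> rel_em2 R0 R1 R2) (em_id2 K) (em_id2 K')"
  unfolding em_id2_def by transfer_prover

lemma em_vcomp_transfer [transfer_rule]:
  "(rel_em2 R0 R1 R2 ===> rel_em2 R0 R1 R2 ===> rel_em2 R0 R1 R2) (em_vcomp K) (em_vcomp K')"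
  unfolding em_vcomp_def by transfer_prover

lemma em_hcomp_transfer [transfer_rule]:
  "(rel_em2 R0 R1 R2 ===> rel_em2 R0 R1 R2 ===> rel_em2 R0 R1 R2) (em_hcomp K) (em_hcomp K')"
  unfolding em_hcomp_def by transfer_prover

text \<open>A 1-cell of \<open>EM\<close> between given monads consists of a 1-cell between their base
  0-cells and of a 2-cell between composites of that 1-cell with the monads, so hom-sets of \<open>K\<close>
  provide partners for both.\<close>

lemma EM_hom1_transfer:
  "(rel_monad R0 R1 R2 ===> rel_monad R0 R1 R2 ===> rel_set (rel_em1 R0 R1 R2))
     (hom1 (EM K)) (hom1 (EM K'))"
proof (intro rel_funI rel_setI)
  fix T T' S S' F
  assume T: "rel_monad R0 R1 R2 T T'" and S: "rel_monad R0 R1 R2 S S'"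
    and "F \<in> hom1 (EM K) T S"
  then have F: "is_em1 K F" "em_src F = T" "em_trg F = S"
    by (simp_all add: hom1_def EM_def)
  then obtain f \<psi> where F_eq: "F = EM1 T S f \<psi>"
    by (metis em1.collapse)
  with F have f: "f \<in> hom1 K (mon_base T) (mon_base S)"
    and \<psi>: "\<psi> \<in> hom2 K (comp1 K (mon_cell S) f) (comp1 K f (mon_cell T))"
    by (auto simp: is_em1_def split: monad.splits)
  have T0: "R0 (mon_base T) (mon_base T')" and T1: "R1 (mon_cell T) (mon_cell T')"
    and S0: "R0 (mon_base S) (mon_base S')" and S1: "R1 (mon_cell S) (mon_cell S')"
    using T S by (auto elim: monad.rel_cases)
  obtain f' where f': "R1 f f'"
    using hom1_left_total [OF f T0 S0] .
  obtain \<psi>' where \<psi>': "R2 \<psi> \<psi>'"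
    using hom2_left_total [OF \<psi> comp1_rel [OF S1 f'] comp1_rel [OF f' T1]] .
  have rel: "rel_em1 R0 R1 R2 F (EM1 T' S' f' \<psi>')"
    using F_eq T S f' \<psi>' by simp
  moreover have "is_em1 K' (EM1 T' S' f' \<psi>')"
    using rel F is_em1_transfer by (auto simp: rel_fun_def)
  ultimately show "\<exists>F'\<in>hom1 (EM K') T' S'. rel_em1 R0 R1 R2 F F'"
    by (auto simp: hom1_def EM_def)
next
  fix T T' S S' F'
  assume T: "rel_monad R0 R1 R2 T T'" and S: "rel_monad R0 R1 R2 S S'"
    and "F' \<in> hom1 (EM K') T' S'"
  then have F': "is_em1 K' F'" "em_src F' = T'" "em_trg F' = S'"
    by (simp_all add: hom1_def EM_def)
  then obtain f' \<psi>' where F'_eq: "F' = EM1 T' S' f' \<psi>'"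
    by (metis em1.collapse)
  with F' have f': "f' \<in> hom1 K' (mon_base T') (mon_base S')"
    and \<psi>': "\<psi>' \<in> hom2 K' (comp1 K' (mon_cell S') f') (comp1 K' f' (mon_cell T'))"
    by (auto simp: is_em1_def split: monad.splits)
  have T0: "R0 (mon_base T) (mon_base T')" and T1: "R1 (mon_cell T) (mon_cell T')"
    and S0: "R0 (mon_base S) (mon_base S')" and S1: "R1 (mon_cell S) (mon_cell S')"
    using T S by (auto elim: monad.rel_cases)
  obtain f where f: "R1 f f'"
    using hom1_right_total [OF f' T0 S0] .
  obtain \<psi> where \<psi>: "R2 \<psi> \<psi>'"
    using hom2_right_total [OF \<psi>' comp1_rel [OF S1 f] comp1_rel [OF f T1]] .
  have rel: "rel_em1 R0 R1 R2 (EM1 T S f \<psi>) F'"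
    using F'_eq T S f \<psi> by simp
  moreover have "is_em1 K (EM1 T S f \<psi>)"
    using rel F' is_em1_transfer by (auto simp: rel_fun_def)
  ultimately show "\<exists>F\<in>hom1 (EM K) T S. rel_em1 R0 R1 R2 F F'"
    by (auto simp: hom1_def EM_def)
qed

lemma EM_hom2_transfer:
  "(rel_em1 R0 R1 R2 ===> rel_em1 R0 R1 R2 ===> rel_set (rel_em2 R0 R1 R2))
     (hom2 (EM K)) (hom2 (EM K'))"
proof (intro rel_funI rel_setI)
  fix F F' G G' R
  assume F: "rel_em1 R0 R1 R2 F F'" and G: "rel_em1 R0 R1 R2 G G'"
    and "R \<in> hom2 (EM K) F G"
  then have R: "is_em2 K R" "em_dom R = F" "em_cod R = G"
    by (simp_all add: hom2_def EM_def)
  then obtain \<rho> where R_eq: "R = EM2 F \<rho> G"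
    by (metis em2.collapse)
  with R have \<rho>: "\<rho> \<in> hom2 K (em_cell F) (comp1 K (em_cell G) (mon_cell (em_src G)))"
    by (auto simp: is_em2_def Let_def split: em1.splits)
  have F1: "R1 (em_cell F) (em_cell F')" and G1: "R1 (em_cell G) (em_cell G')"
    and T1: "R1 (mon_cell (em_src G)) (mon_cell (em_src G'))"
    using F G by (auto elim!: em1.rel_cases monad.rel_cases)
  obtain \<rho>' where \<rho>': "R2 \<rho> \<rho>'"
    using hom2_left_total [OF \<rho> F1 comp1_rel [OF G1 T1]] .
  have rel: "rel_em2 R0 R1 R2 R (EM2 F' \<rho>' G')"
    using R_eq F G \<rho>' by simp
  moreover have "is_em2 K' (EM2 F' \<rho>' G')"
    using rel R is_em2_transfer by (auto simp: rel_fun_def)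
  ultimately show "\<exists>R'\<in>hom2 (EM K') F' G'. rel_em2 R0 R1 R2 R R'"
    by (auto simp: hom2_def EM_def)
next
  fix F F' G G' R'
  assume F: "rel_em1 R0 R1 R2 F F'" and G: "rel_em1 R0 R1 R2 G G'"
    and "R' \<in> hom2 (EM K') F' G'"
  then have R': "is_em2 K' R'" "em_dom R' = F'" "em_cod R' = G'"
    by (simp_all add: hom2_def EM_def)
  then obtain \<rho>' where R'_eq: "R' = EM2 F' \<rho>' G'"
    by (metis em2.collapse)
  with R' have \<rho>': "\<rho>' \<in> hom2 K' (em_cell F') (comp1 K' (em_cell G') (mon_cell (em_src G')))"
    by (auto simp: is_em2_def Let_def split: em1.splits)
  have F1: "R1 (em_cell F) (em_cell F')" and G1: "R1 (em_cell G) (em_cell G')"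
    and T1: "R1 (mon_cell (em_src G)) (mon_cell (em_src G'))"
    using F G by (auto elim!: em1.rel_cases monad.rel_cases)
  obtain \<rho> where \<rho>: "R2 \<rho> \<rho>'"
    using hom2_right_total [OF \<rho>' F1 comp1_rel [OF G1 T1]] .
  have rel: "rel_em2 R0 R1 R2 (EM2 F \<rho> G) R'"
    using R'_eq F G \<rho> by simp
  moreover have "is_em2 K (EM2 F \<rho> G)"
    using rel R' is_em2_transfer by (auto simp: rel_fun_def)
  ultimately show "\<exists>R\<in>hom2 (EM K) F G. rel_em2 R0 R1 R2 R R'"
    by (auto simp: hom2_def EM_def)
qed

text \<open>The operations and constraints of \<open>EM(K)\<close> are given by formulas in those of \<open>K\<close>,
  so they respect the induced relations.\<close>

lemma EM_correspondence:
  "bicategory_correspondence (EM K) (EM K')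
     (rel_monad R0 R1 R2) (rel_em1 R0 R1 R2) (rel_em2 R0 R1 R2)"
proof unfold_locales
  show "bi_unique (rel_monad R0 R1 R2)" "bi_unique (rel_em1 R0 R1 R2)"
    "bi_unique (rel_em2 R0 R1 R2)"
    by (intro monad.bi_unique_rel em1.bi_unique_rel em2.bi_unique_rel
      bi_unique0 bi_unique1 bi_unique2)+
  show "T \<in> cells0 (EM K) \<longleftrightarrow> T' \<in> cells0 (EM K')" if "rel_monad R0 R1 R2 T T'" for T T'
    using that is_monad_transfer by (auto simp: EM_def rel_fun_def)
qed (rule EM_hom1_transfer EM_hom2_transfer | simp add: EM_def, transfer_prover)+

end

unbundle no lifting_syntax


section \<open>Bimodules over one algebra\<close>

text \<open>The bimodule underlying \<open>M \<otimes>\<^sub>A N\<close> has the left algebra of \<open>M\<close> and the right algebra of \<open>N\<close>, so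
  the \<open>A\<close>-bimodules are closed under composition. As \<open>A\<close> is coflat,
  an \<open>A\<close>-bimodule is a 1-cell of \<open>Bim C\<close> exactly if it is right robust, and both structures have all
  bimodule morphisms between such objects.\<close>

lemma Bim_correspondence:
  assumes "coflat_algebra C A"
  shows "bicategory_correspondence (Bim C) (one_object_bicategory (robust_bimodules C A))
           (\<lambda>B _. B = A) (\<lambda>M N. M = N \<and> bim_left M = A \<and> bim_right M = A) (=)"
  by unfold_locales
    (use assms in \<open>auto simp: bi_unique_def rel_fun_def rel_set_def hom1_def hom2_def Bim_def
      one_object_bicategory_def robust_bimodules_def bim_tensor_def regular_bimodule_def\<close>)

text \<open>Over \<open>A\<close>, the relations between the cells are the graphs of the constant map on the 0-cell and of
  restricted identities. So the induced relations are graphs of the induced maps on monads and on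
  \<open>EM\<close> cells, of which \<open>wreath_to_pair\<close> is composed.\<close>

lemma wreath_to_pair_eqI:
  fixes W :: "('c, 'f, 'm) wreath" and A :: 'c and P :: "'f \<Rightarrow> bool"
  defines "R0 \<equiv> \<lambda>(B :: 'c) (_ :: unit). B = A" and "R1 \<equiv> \<lambda>f g. f = g \<and> P f"
    and "R2 \<equiv> ((=) :: 'm \<Rightarrow> 'm \<Rightarrow> bool)"
  assumes "rel_monad (rel_monad R0 R1 R2) (rel_em1 R0 R1 R2) (rel_em2 R0 R1 R2) W X"
  shows "wreath_to_pair W = (A, X)"
proof -
  have monad: "mon_base T = A" "map_monad (\<lambda>_. ()) id id T = T'" if "rel_monad R0 R1 R2 T T'" for T T'
    using that by (auto simp: R0_def R1_def R2_def elim!: monad.rel_cases)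
  have em1: "map_em1 (\<lambda>_. ()) id id F = F'" if "rel_em1 R0 R1 R2 F F'" for F F'
    using that by (auto simp: R1_def R2_def monad elim!: em1.rel_cases)
  have em2: "map_em2 (\<lambda>_. ()) id id \<rho> = \<rho>'" if "rel_em2 R0 R1 R2 \<rho> \<rho>'" for \<rho> \<rho>'
    using that by (auto simp: R2_def em1 elim!: em2.rel_cases)
  show ?thesis
    using assms(4)
    by (cases W; cases X) (auto simp: wreath_to_pair_def monad em1 em2)
qed


section \<open>Letting the algebra vary\<close>

lemma mon_base_EM_monad: "is_monad (EM K) W \<Longrightarrow> is_monad K (mon_base W)"
proof -
  have "T \<in> cells0 (EM K) \<Longrightarrow> is_monad K T" for T
    by (simp add: EM_def)
  then show "is_monad (EM K) W \<Longrightarrow> is_monad K (mon_base W)"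
    by (cases W) (simp add: is_monad_def [of "EM K"])
qed

lemma mon_base_EM_comonad: "is_comonad (EM K) W \<Longrightarrow> is_monad K (mon_base W)"
proof -
  have "T \<in> cells0 (EM K) \<Longrightarrow> is_monad K T" for T
    by (simp add: EM_def)
  then show "is_comonad (EM K) W \<Longrightarrow> is_monad K (mon_base W)"
    by (cases W) (simp add: is_comonad_def)
qed

text \<open>The form in which one correspondence for each algebra \<open>A\<close> is assembled into a single bijection:
  the relations \<open>R A\<close> are injective partial functions, and \<open>p\<close> records both the value and the
  parameter \<open>A\<close>, so the domains of the \<open>R A\<close> are disjoint and injectivity on each of them
  is enough.\<close>

lemma bij_betw_pairs_of_relations:
  assumes graph: "\<And>A W X. P A \<Longrightarrow> R A W X \<Longrightarrow> p W = (A, X)"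
    and left_unique: "\<And>A W W' X. P A \<Longrightarrow> R A W X \<Longrightarrow> R A W' X \<Longrightarrow> W = W'"
    and left_total: "\<And>W. W \<in> Ws \<Longrightarrow> \<exists>A X. P A \<and> X \<in> Xs A \<and> R A W X"
    and right_total: "\<And>A X. P A \<Longrightarrow> X \<in> Xs A \<Longrightarrow> \<exists>W\<in>Ws. R A W X"
  shows "bij_betw p Ws {(A, X). P A \<and> X \<in> Xs A}"
proof (rule bij_betw_imageI)
  show "inj_on p Ws"
  proof (rule inj_onI)
    fix W W' assume "W \<in> Ws" "W' \<in> Ws" and eq: "p W = p W'"
    then obtain A X A' X' where *: "P A" "R A W X" "P A'" "R A' W' X'"
      using left_total by blast
    then have "(A, X) = (A', X')"
      using graph eq by metis
    with * show "W = W'"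
      using left_unique by blast
  qed
  show "p ` Ws = {(A, X). P A \<and> X \<in> Xs A}"
  proof (intro equalityI subsetI)
    fix Y assume "Y \<in> p ` Ws"
    then show "Y \<in> {(A, X). P A \<and> X \<in> Xs A}"
      using graph left_total by force
  next
    fix Y assume "Y \<in> {(A, X). P A \<and> X \<in> Xs A}"
    then obtain A X where Y: "Y = (A, X)" "P A" "X \<in> Xs A"
      by blast
    then obtain W where "W \<in> Ws" "R A W X"
      using right_total by blast
    with Y show "Y \<in> p ` Ws"
      using graph by (metis image_eqI)
  qed
qed

theorem theorem6p8:
  fixes C :: "('o, 'a) tensor_category"
  assumes "strict_monoidal_category C"
    and "has_coequalizers C"
  shows "bij_betw wreath_to_pair (wreaths (Bim C))
           {(A, X). coflat_algebra C A
                  \<and> X \<in> wreaths (one_object_bicategory (robust_bimodules C A))}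
       \<and> bij_betw wreath_to_pair (cowreaths (Bim C))
           {(A, X). coflat_algebra C A
                  \<and> X \<in> cowreaths (one_object_bicategory (robust_bimodules C A))}"
proof -
  define R0 where "R0 = (\<lambda>(A :: ('o, 'a) algebra) B (_ :: unit). B = A)"
  define R1 where
    "R1 = (\<lambda>A (M :: ('o, 'a) bimodule) N. M = N \<and> bim_left M = A \<and> bim_right M = A)"
  define R2 where "R2 = ((=) :: ('o, 'a) bimodule_map \<Rightarrow> _)"
  define R where "R = (\<lambda>A. rel_monad (rel_monad (R0 A) (R1 A) R2)
    (rel_em1 (R0 A) (R1 A) R2) (rel_em2 (R0 A) (R1 A) R2))"
  let ?D = "\<lambda>A. one_object_bicategory (robust_bimodules C A)"
  have cells: "bicategory_correspondence (Bim C) (?D A) (R0 A) (R1 A) R2"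
    if "coflat_algebra C A" for A
    unfolding R0_def R1_def R2_def using that by (rule Bim_correspondence)
  have em: "bicategory_correspondence (EM (Bim C)) (EM (?D A)) (rel_monad (R0 A) (R1 A) R2)
    (rel_em1 (R0 A) (R1 A) R2) (rel_em2 (R0 A) (R1 A) R2)" if "coflat_algebra C A" for A
    using that by (intro bicategory_correspondence.EM_correspondence cells)
  have graph: "wreath_to_pair W = (A, X)" if "R A W X" for A W X
    using that unfolding R_def R0_def R1_def R2_def by (rule wreath_to_pair_eqI)
  have left_unique: "W = W'" if "coflat_algebra C A" "R A W X" "R A W' X" for A W W' X
  proof -
    have "bi_unique (R A)"
      unfolding R_def
      by (rule monad.bi_unique_rel [OF bicategory_correspondence.bi_unique0 [OF em [OF that(1)]]
        bicategory_correspondence.bi_unique1 [OF em [OF that(1)]]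
        bicategory_correspondence.bi_unique2 [OF em [OF that(1)]]])
    with that show ?thesis
      by (auto simp: bi_unique_def)
  qed
  (* The monad underlying a wreath determines the algebra A over which it is compared. *)
  have base_left: "\<exists>A T'. coflat_algebra C A \<and> rel_monad (R0 A) (R1 A) R2 T T'"
    if T: "is_monad (Bim C) T" for T
  proof -
    have A: "coflat_algebra C (mon_base T)"
      using T by (auto simp: is_monad_def Bim_def split: monad.splits)
    have "R0 (mon_base T) (mon_base T) ()"
      by (simp add: R0_def)
    with A show ?thesis
      using bicategory_correspondence.monad_left_total [OF cells T] by metis
  qed
  have base_right: "\<exists>T. rel_monad (R0 A) (R1 A) R2 T T'"
    if "coflat_algebra C A" "is_monad (?D A) T'" for A T'
  proof -
    have "R0 A A (mon_base T')"
      by (simp add: R0_def)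
    with that show ?thesis
      using bicategory_correspondence.monad_right_total [OF cells] by metis
  qed
  have "bij_betw wreath_to_pair (wreaths (Bim C)) {(A, X). coflat_algebra C A \<and> X \<in> wreaths (?D A)}"
  proof (rule bij_betw_pairs_of_relations [where R = R])
    fix W assume "W \<in> wreaths (Bim C)"
    then have W: "is_monad (EM (Bim C)) W"
      by (simp add: wreaths_def)
    then have "is_monad (Bim C) (mon_base W)"
      by (rule mon_base_EM_monad)
    then obtain A T' where A: "coflat_algebra C A"
      and T': "rel_monad (R0 A) (R1 A) R2 (mon_base W) T'"
      using base_left by blast
    obtain X where "is_monad (EM (?D A)) X" "R A W X"
      unfolding R_def by (rule bicategory_correspondence.monad_left_total [OF em [OF A] W T'])
    with A show "\<exists>A X. coflat_algebra C A \<and> X \<in> wreaths (?D A) \<and> R A W X"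
      unfolding wreaths_def by blast
  next
    fix A X assume A: "coflat_algebra C A" and "X \<in> wreaths (?D A)"
    then have X: "is_monad (EM (?D A)) X"
      by (simp add: wreaths_def)
    then have "is_monad (?D A) (mon_base X)"
      by (rule mon_base_EM_monad)
    then obtain T where T: "rel_monad (R0 A) (R1 A) R2 T (mon_base X)"
      using base_right A by blast
    obtain W where "is_monad (EM (Bim C)) W" "R A W X"
      unfolding R_def by (rule bicategory_correspondence.monad_right_total [OF em [OF A] X T])
    then show "\<exists>W\<in>wreaths (Bim C). R A W X"
      unfolding wreaths_def by blast
  qed (use graph left_unique in blast)+
  moreover
  have "bij_betw wreath_to_pair (cowreaths (Bim C)) {(A, X). coflat_algebra C A \<and> X \<in> cowreaths (?D A)}"
  proof (rule bij_betw_pairs_of_relations [where R = R])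
    fix W assume "W \<in> cowreaths (Bim C)"
    then have W: "is_comonad (EM (Bim C)) W"
      by (simp add: cowreaths_def)
    then have "is_monad (Bim C) (mon_base W)"
      by (rule mon_base_EM_comonad)
    then obtain A T' where A: "coflat_algebra C A"
      and T': "rel_monad (R0 A) (R1 A) R2 (mon_base W) T'"
      using base_left by blast
    obtain X where "is_comonad (EM (?D A)) X" "R A W X"
      unfolding R_def by (rule bicategory_correspondence.comonad_left_total [OF em [OF A] W T'])
    with A show "\<exists>A X. coflat_algebra C A \<and> X \<in> cowreaths (?D A) \<and> R A W X"
      unfolding cowreaths_def by blast
  next
    fix A X assume A: "coflat_algebra C A" and "X \<in> cowreaths (?D A)"
    then have X: "is_comonad (EM (?D A)) X"
      by (simp add: cowreaths_def)
    then have "is_monad (?D A) (mon_base X)"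
      by (rule mon_base_EM_comonad)
    then obtain T where T: "rel_monad (R0 A) (R1 A) R2 T (mon_base X)"
      using base_right A by blast
    obtain W where "is_comonad (EM (Bim C)) W" "R A W X"
      unfolding R_def by (rule bicategory_correspondence.comonad_right_total [OF em [OF A] X T])
    then show "\<exists>W\<in>cowreaths (Bim C). R A W X"
      unfolding cowreaths_def by blast
  qed (use graph left_unique in blast)+
  ultimately show ?thesis ..
qed

end
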